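(* For all integers $k\geq3$ and $n\geq1$, the $n$th second $k$-gonal number $\frac{n}{2}\big((k-2)n+(k-4)\big)$ equals the number of $(k-3)$-box paths of size $n+1$ with exactly two long ascents.
   Context: A skew Dyck path is a word $w$ over $\{U,D,L\}$ such that: $w$ contains neither $UL$ nor $LU$ as a contiguous subword; the number of $U$s equals the total number of $D$s and $L$s; and in every prefix the total number of $D$s and $L$s is at most the number of $U$s. Its semilength is its number of $U$s. A factor is a contiguous subword; $X^{m}$ denotes $m$ consecutive copies of $X$. For $k\geq1$, a $k$-box path of size $n$ is a skew Dyck path of semilength $(k+2)n-1$ containing exactly $n$ occurrences of the factor $UD^{k}L$. By convention, a $0$-box path of size $n$ is the word obtained from a Dyck path (word in $U,D$) of semilength $n-1$ by replacing each $D$ with $ULD$ and appending $UL$ at the end (so $0$-box paths of size $n$ correspond bijectively to Dyck paths of semilength $n-1$; their long ascents correspond to the peaks, i.e. $UD$-factors, of the Dyck path). An ascent is a maximal run of consecutive $U$s; a long ascent is an ascent consisting of at least two $U$s. The second $k$-gonal numbers are obtained from the $k$-gonal number formula $\frac{n}{2}((k-2)n-(k-4))$ by replacing $n$ with $-n$. *)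

theory Defs
  imports Complex_Main "HOL-Library.Sublist"
begin

datatype step = U | D | L

definition semilength :: "step list \<Rightarrow> nat" where
  "semilength w = count_list w U"

definition balanced :: "step list \<Rightarrow> bool" where
  "balanced w \<longleftrightarrow>
     count_list w U = count_list w D + count_list w L \<and>
     (\<forall>p. prefix p w \<longrightarrow> count_list p D + count_list p L \<le> count_list p U)"

definition dyck_path :: "step list \<Rightarrow> bool" where
  "dyck_path w \<longleftrightarrow> set w \<subseteq> {U, D} \<and> balanced w"

definition skew_dyck_path :: "step list \<Rightarrow> bool" where
  "skew_dyck_path w \<longleftrightarrow> \<not> sublist [U, L] w \<and> \<not> sublist [L, U] w \<and> balanced w"

(* An occurrence of f in w is identified with the part of w that precedes it. *)
definition occurrences :: "step list \<Rightarrow> step list \<Rightarrow> nat" where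
  "occurrences f w = card {p. \<exists>s. w = p @ f @ s}"

(* Replaces each D by ULD and appends UL. *)
definition zero_box_word :: "step list \<Rightarrow> step list" where
  "zero_box_word d = concat (map (\<lambda>x. if x = D then [U, L, D] else [x]) d) @ [U, L]"

(* The semilengths (k+2)n-1 and n-1 are written without truncated subtraction. *)
definition box_path :: "nat \<Rightarrow> nat \<Rightarrow> step list \<Rightarrow> bool" where
  "box_path k n w \<longleftrightarrow>
     (if k = 0
      then \<exists>d. dyck_path d \<and> semilength d + 1 = n \<and> w = zero_box_word d
      else skew_dyck_path w \<and> semilength w + 1 = (k + 2) * n \<and>
           occurrences ([U] @ replicate k D @ [L]) w = n)"

(* (p, m, s) describes the maximal run of m steps U standing between p and s. *)
definition ascents :: "step list \<Rightarrow> (step list \<times> nat \<times> step list) set" where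
  "ascents w = {(p, m, s). w = p @ replicate m U @ s \<and> m \<ge> 1 \<and>
                  (p = [] \<or> last p \<noteq> U) \<and> (s = [] \<or> hd s \<noteq> U)}"

definition long_ascents :: "step list \<Rightarrow> (step list \<times> nat \<times> step list) set" where
  "long_ascents w = {(p, m, s) \<in> ascents w. m \<ge> 2}"

definition polygonal :: "nat \<Rightarrow> int \<Rightarrow> real" where
  "polygonal k n = of_int n / 2 * ((real k - 2) * of_int n - (real k - 4))"

definition second_polygonal :: "nat \<Rightarrow> nat \<Rightarrow> real" where
  "second_polygonal k n = polygonal k (- int n)"

end

theory Submission
  imports Defs
begin

text \<open>
  With $K = k - 3$, the $K$-box paths of size $n + 1$ are exactly the balanced words
  $U^{a} D^K L \cdot D U^{b_1} D^K L \cdots D U^{b_n} D^K L$ with all exponents positive; this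
  holds for $K = 0$ as well. Balance forces $a \ge 2$, so two long ascents means
  that exactly one $b_i$ exceeds $1$. If it is followed by $r$ ones, balance determines $a$ and
  leaves $2 \le b_i \le (K+1)(r+1)$, so the count is $\sum_{r<n} ((K+1)(r+1) - 1)$.
\<close>

section \<open>Words made of boxes, coded by their ascent lengths\<close>

text \<open>The first exponent stands apart because no separating \<open>D\<close> precedes the
  first box. Positivity of the exponents is imposed separately.\<close>

definition box_word :: "nat \<Rightarrow> nat \<Rightarrow> nat list \<Rightarrow> step list" where
  "box_word K a bs = replicate a U @ replicate K D @ L #
     concat (map (\<lambda>b. D # replicate b U @ replicate K D @ [L]) bs)"

lemma box_word_Nil: "box_word K a [] = replicate a U @ replicate K D @ [L]"
  by (simp add: box_word_def)

lemma box_word_Cons: "box_word K a (b # bs) = replicate a U @ replicate K D @ L # D # box_word K b bs"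
  by (simp add: box_word_def)

lemma box_word_Suc: "box_word K (Suc a) bs = U # box_word K a bs"
  by (simp add: box_word_def)

lemma hd_replicate_D: "hd (replicate K D @ L # x) \<noteq> U"
  by (cases K) auto

text \<open>Neither remainder starts with \<open>x\<close>, so both runs are the maximal initial run
  of one and the same word.\<close>

lemma replicate_append_cancel:
  assumes "replicate a x @ u = replicate b x @ v" "hd u \<noteq> x" "hd v \<noteq> x" "u \<noteq> []" "v \<noteq> []"
  shows "a = b \<and> u = v"
  using assms
proof (induction a arbitrary: b)
  case 0
  then show ?case by (cases b) auto
next
  case (Suc a)
  then show ?case by (cases b) auto
qed

text \<open>Stripping the initial run of \<open>U\<close> and then the fixed block behind it reads
  the exponents back one by one. Hence paths can be counted by their exponents.\<close>

lemma box_word_inject: "box_word K a bs = box_word K a' bs' \<longleftrightarrow> a = a' \<and> bs = bs'"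
proof (induction bs arbitrary: a a' bs')
  case Nil
  show ?case
  proof (cases bs')
    case Nil
    then show ?thesis
      by (auto simp: box_word_Nil)
  next
    case (Cons b cs)
    then show ?thesis
      using replicate_append_cancel[of a U "replicate K D @ [L]" a' "replicate K D @ L # D # box_word K b cs"]
      by (auto simp: box_word_Nil box_word_Cons hd_replicate_D)
  qed
next
  case (Cons c bs)
  show ?case
  proof (cases bs')
    case Nil
    then show ?thesis
      using replicate_append_cancel[of a U "replicate K D @ L # D # box_word K c bs" a' "replicate K D @ [L]"]
      by (auto simp: box_word_Nil box_word_Cons hd_replicate_D)
  next
    case (Cons b cs)
    then show ?thesis
      using Cons.IH[of c b cs] replicate_append_cancel[of a U "replicate K D @ L # D # box_word K c bs"
          a' "replicate K D @ L # D # box_word K b cs"]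
      by (auto simp: box_word_Cons hd_replicate_D)
  qed
qed

lemma count_list_replicate: "count_list (replicate n x) y = (if x = y then n else 0)"
  by (induction n) auto

lemma count_box_word:
  "count_list (box_word K a bs) U = a + sum_list bs"
  "count_list (box_word K a bs) D = K * (length bs + 1) + length bs"
  "count_list (box_word K a bs) L = length bs + 1"
  by (induction bs arbitrary: a) (auto simp: box_word_Nil box_word_Cons count_list_replicate)

section \<open>Forbidden turns\<close>

lemma sublist_pair_iff: "sublist [x, y] (z # w) \<longleftrightarrow> (x = z \<and> w \<noteq> [] \<and> hd w = y) \<or> sublist [x, y] w"
  by (cases w) (auto simp: sublist_Cons_right)

text \<open>A condition on adjacent letters splits over \<open>@\<close>, so a box word can be
  checked block by block.\<close>

lemma no_turn_iff_successively:
  "\<not> sublist [U, L] w \<and> \<not> sublist [L, U] w \<longleftrightarrow>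
     successively (\<lambda>x y. \<not> (x = U \<and> y = L) \<and> \<not> (x = L \<and> y = U)) w"
  by (induction w) (auto simp: sublist_pair_iff successively_Cons)

lemma successively_replicate: "P x x \<Longrightarrow> successively P (replicate n x)"
proof (induction n)
  case (Suc n)
  then show ?case by (cases n) auto
qed simp

text \<open>For \<open>K \<ge> 1\<close> a block of \<open>D\<close> separates each ascent from the
  next \<open>L\<close>, and each \<open>L\<close> but the last is followed by \<open>D\<close>. For
  \<open>K = 0\<close> the box itself is the factor UL.\<close>

lemma box_word_no_turn:
  assumes "K \<ge> 1" "a \<ge> 1" "\<forall>b\<in>set bs. b \<ge> 1"
  shows "\<not> sublist [U, L] (box_word K a bs) \<and> \<not> sublist [L, U] (box_word K a bs)"
  unfolding no_turn_iff_successively using assms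
proof (induction bs arbitrary: a)
  case Nil
  then show ?case
    by (auto simp: box_word_Nil successively_append_iff successively_replicate successively_Cons)
next
  case (Cons b bs)
  then show ?case
    by (auto simp: box_word_Cons successively_append_iff successively_replicate successively_Cons)
qed

section \<open>Occurrences of the box factor\<close>

lemma finite_occurrence_positions: "finite {p. \<exists>s. w = p @ f @ s}"
  by (rule finite_subset[of _ "set (prefixes w)"]) (auto simp: prefix_def)

lemma occurrences_Nil: "f \<noteq> [] \<Longrightarrow> occurrences f [] = 0"
  by (simp add: occurrences_def)

text \<open>An occurrence either starts at the head, or its preceding part begins with
  \<open>x\<close> and comes from an occurrence in \<open>w\<close>.\<close>

lemma occurrences_Cons:
  assumes "f \<noteq> []"
  shows "occurrences f (x # w) = (if prefix f (x # w) then 1 else 0) + occurrences f w"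
proof -
  have "{p. \<exists>s. x # w = p @ f @ s} =
      (if prefix f (x # w) then {[]} else {}) \<union> (#) x ` {p. \<exists>s. w = p @ f @ s}" (is "?A = ?B")
  proof (rule set_eqI)
    fix p
    show "p \<in> ?A \<longleftrightarrow> p \<in> ?B"
      by (cases p) (auto simp: prefix_def)
  qed
  then show ?thesis
    using finite_occurrence_positions[of w f]
    by (auto simp: occurrences_def card_image card_insert_if)
qed

lemma occurrences_append_notin:
  "x \<notin> set u \<Longrightarrow> occurrences (x # f) (u @ v) = occurrences (x # f) v"
  by (induction u) (auto simp: occurrences_Cons)

abbreviation box :: "nat \<Rightarrow> step list" where
  "box K \<equiv> [U] @ replicate K D @ [L]"

text \<open>Only the last \<open>U\<close> of a run can open a box, because the second letter of a
  box is never \<open>U\<close>.\<close>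

lemma occurrences_box_run:
  assumes "hd v \<noteq> U"
  shows "occurrences (box K) (replicate (Suc a) U @ v) =
    (if prefix (replicate K D @ [L]) v then 1 else 0) + occurrences (box K) v"
proof (induction a)
  case 0
  then show ?case by (simp add: occurrences_Cons)
next
  case (Suc a)
  have "\<not> prefix (box K) (U # U # replicate a U @ v)"
    by (cases K) auto
  with Suc show ?case by (simp add: occurrences_Cons)
qed

text \<open>Positivity supplies every block with the \<open>U\<close> that opens its box.\<close>

lemma occurrences_box_word:
  assumes "a \<ge> 1" "\<forall>b\<in>set bs. b \<ge> 1"
  shows "occurrences (box K) (box_word K a bs) = length bs + 1"
  using assms
proof (induction bs arbitrary: a)
  case Nil
  then obtain c where "a = Suc c" by (cases a) auto
  then show ?case
    using occurrences_box_run[of "replicate K D @ [L]" K c]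
      occurrences_append_notin[of U "replicate K D @ [L]" "replicate K D @ [L]" "[]"]
    by (simp add: box_word_Nil hd_replicate_D occurrences_Nil)
next
  case (Cons b bs)
  then obtain c where "a = Suc c" by (cases a) auto
  moreover have "prefix (replicate K D @ [L]) (replicate K D @ L # D # box_word K b bs)"
    by simp
  ultimately show ?case
    using Cons occurrences_box_run[of "replicate K D @ L # D # box_word K b bs" K c]
      occurrences_append_notin[of U "replicate K D @ [L, D]" "replicate K D @ [L]" "box_word K b bs"]
    by (simp add: box_word_Cons hd_replicate_D)
qed

text \<open>
  Since $LU$ is forbidden, consecutive boxes are separated by a further $D$; so $m$ boxes force at
  least $(K+2)m - 1$ down steps, and equality leaves no freedom except the ascent lengths.
\<close>

lemma box_count_bound:
  assumes "\<not> sublist [L, U] w"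
  shows "(K + 2) * occurrences (box K) w \<le> count_list w D + count_list w L + 1 \<and>
    ((K + 2) * occurrences (box K) w = count_list w D + count_list w L + 1 \<longrightarrow>
      (\<exists>a bs. a \<ge> 1 \<and> (\<forall>b\<in>set bs. b \<ge> 1) \<and> w = box_word K a bs))"
  using assms
\<comment> \<open>A box is removed together with the letter behind it, hence induction on the
  length.\<close>
proof (induction w rule: length_induct)
  case (1 w)
  show ?case
  proof (cases w)
    case Nil
    then show ?thesis by (simp add: occurrences_Nil)
  next
    case w: (Cons x v)
    have IH: "(K + 2) * occurrences (box K) v \<le> count_list v D + count_list v L + 1 \<and>
      ((K + 2) * occurrences (box K) v = count_list v D + count_list v L + 1 \<longrightarrow>
        (\<exists>a bs. a \<ge> 1 \<and> (\<forall>b\<in>set bs. b \<ge> 1) \<and> v = box_word K a bs))"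
      using 1(1)[rule_format, of v] 1(2) w by (simp add: sublist_pair_iff)
    show ?thesis
    proof (cases "prefix (box K) w")
      case False
      then have occ: "occurrences (box K) w = occurrences (box K) v"
        unfolding w by (simp add: occurrences_Cons)
      show ?thesis
      proof (cases "x = U")
        case True
        have "\<exists>a bs. a \<ge> 1 \<and> (\<forall>b\<in>set bs. b \<ge> 1) \<and> U # v = box_word K a bs"
          if "v = box_word K a bs" "\<forall>b\<in>set bs. b \<ge> 1" for a bs
          using that by (intro exI[of _ "Suc a"] exI[of _ bs]) (simp add: box_word_Suc)
        then have ex: "\<exists>a bs. a \<ge> 1 \<and> (\<forall>b\<in>set bs. b \<ge> 1) \<and> w = box_word K a bs"
          if "\<exists>a bs. a \<ge> 1 \<and> (\<forall>b\<in>set bs. b \<ge> 1) \<and> v = box_word K a bs"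
          using that True w by blast
        have "count_list w D = count_list v D" "count_list w L = count_list v L"
          using True w by simp_all
        with IH ex show ?thesis
          unfolding occ by presburger
      next
        case False
        \<comment> \<open>A down step that opens no box makes the inequality strict, so the equality
          case does not arise.\<close>
        then have "count_list w D + count_list w L = Suc (count_list v D + count_list v L)"
          using w by (cases x) auto
        with IH show ?thesis unfolding occ by linarith
      qed
    next
      case True
      then obtain s where s: "w = box K @ s"
        by (auto simp: prefix_def)
      have occ: "occurrences (box K) w = 1 + occurrences (box K) s"
        using True s occurrences_append_notin[of U "replicate K D @ [L]" "replicate K D @ [L]" s]
        by (simp add: occurrences_Cons)
      show ?thesis
      proof (cases s)
        case Nil
        \<comment> \<open>The last box has \<open>K + 1\<close> down steps and no separator behind
          it; this is the source of the \<open>+ 1\<close> in the bound.\<close>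
        have "w = box_word K 1 []" using s Nil by (simp add: box_word_Nil)
        then show ?thesis
          using occ Nil count_box_word[of K 1 "[]"] by (force simp: occurrences_Nil)
      next
        case s': (Cons y t)
        have sub: "\<not> sublist [L, U] (L # y # t)"
        proof
          assume "sublist [L, U] (L # y # t)"
          moreover have "w = (U # replicate K D) @ (L # y # t)" using s s' by simp
          then have "sublist (L # y # t) w" unfolding sublist_def by (metis append_Nil2)
          ultimately show False using 1(2) sublist_order.order.trans by blast
        qed
        then have y: "y \<noteq> U" and nt: "\<not> sublist [L, U] t" and yt: "y = L \<longrightarrow> t = [] \<or> hd t \<noteq> U"
          by (auto simp: sublist_pair_iff)
        have occ': "occurrences (box K) w = 1 + occurrences (box K) t"
          using occ y s' by (simp add: occurrences_Cons)
        \<comment> \<open>The box contributes \<open>K + 1\<close> down steps and the letter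
          \<open>y\<close> one more.\<close>
        have cnt: "count_list w D + count_list w L = K + 2 + (count_list t D + count_list t L)"
          using y s s' by (cases y) (auto simp: count_list_replicate)
        have len: "length t < length w" using s s' by simp
        have ex: "\<exists>a bs. a \<ge> 1 \<and> (\<forall>b\<in>set bs. b \<ge> 1) \<and> w = box_word K a bs"
          if "t = box_word K a bs" "a \<ge> 1" "\<forall>b\<in>set bs. b \<ge> 1" for a bs
        proof -
          have "t \<noteq> [] \<and> hd t = U"
            using that by (cases a) (auto simp: box_word_Suc)
          \<comment> \<open>As \<open>t\<close> starts with \<open>U\<close>, the choice
            \<open>y = L\<close> would create the factor LU.\<close>
          with y yt have "y = D" by (cases y) auto
          with that s s' show ?thesis
            by (intro exI[of _ 1] exI[of _ "a # bs"]) (simp add: box_word_Cons)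
        qed
        have "(K + 2) * occurrences (box K) w = K + 2 + (K + 2) * occurrences (box K) t"
          unfolding occ' by simp
        with 1(1)[rule_format, OF len nt] ex show ?thesis
          unfolding cnt by (metis (no_types, lifting) add.assoc add_le_cancel_left add_left_cancel)
      qed
    qed
  qed
qed

section \<open>Balance as a condition on heights\<close>

text \<open>The prefix condition read letter by letter from height \<open>h\<close>. The guard
  \<open>0 < h\<close> keeps the truncated \<open>h - 1\<close> from hiding a negative
  height.\<close>

fun stays_nonneg :: "nat \<Rightarrow> step list \<Rightarrow> bool" where
  "stays_nonneg h [] = True"
| "stays_nonneg h (U # w) = stays_nonneg (Suc h) w"
| "stays_nonneg h (D # w) = (0 < h \<and> stays_nonneg (h - 1) w)"
| "stays_nonneg h (L # w) = (0 < h \<and> stays_nonneg (h - 1) w)"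

lemma all_prefix_Cons: "(\<forall>p. prefix p (x # w) \<longrightarrow> P p) \<longleftrightarrow> P [] \<and> (\<forall>p. prefix p w \<longrightarrow> P (x # p))"
  by (auto simp: prefix_Cons)

lemma stays_nonneg_iff:
  "stays_nonneg h w \<longleftrightarrow> (\<forall>p. prefix p w \<longrightarrow> count_list p D + count_list p L \<le> h + count_list p U)"
proof (induction w arbitrary: h)
  case Nil
  then show ?case by simp
next
  case (Cons x w)
  have down: "(0 < h \<and> (\<forall>p. prefix p w \<longrightarrow> count_list p D + count_list p L \<le> h - 1 + count_list p U)) \<longleftrightarrow>
    (\<forall>p. prefix p w \<longrightarrow> Suc (count_list p D + count_list p L) \<le> h + count_list p U)" (is "?A \<longleftrightarrow> ?B")
  proof
    assume ?B
    \<comment> \<open>The empty prefix already shows that a down step is affordable.\<close>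
    then have "0 < h" by (auto dest: spec[of _ "[]"])
    with \<open>?B\<close> show ?A by fastforce
  qed fastforce
  show ?case
    using down by (cases x) (simp_all add: all_prefix_Cons Cons)
qed

lemma balanced_iff:
  "balanced w \<longleftrightarrow> count_list w U = count_list w D + count_list w L \<and> stays_nonneg 0 w"
  by (simp add: balanced_def stays_nonneg_iff)

lemma stays_nonneg_U: "stays_nonneg h (replicate a U @ w) \<longleftrightarrow> stays_nonneg (h + a) w"
  by (induction a arbitrary: h) auto

lemma stays_nonneg_D: "stays_nonneg h (replicate a D @ w) \<longleftrightarrow> a \<le> h \<and> stays_nonneg (h - a) w"
proof (induction a arbitrary: h)
  case (Suc a)
  then show ?case by (cases h) auto
qed simp

text \<open>Here \<open>h\<close> is the height at the top of the current ascent. A box with its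
  separator descends by \<open>K + 2\<close>, the last box by \<open>K + 1\<close>. It suffices to
  test the bottom of each descent.\<close>

fun ballot :: "nat \<Rightarrow> nat \<Rightarrow> nat list \<Rightarrow> bool" where
  "ballot K h [] \<longleftrightarrow> K + 1 \<le> h"
| "ballot K h (b # bs) \<longleftrightarrow> K + 2 \<le> h \<and> ballot K (h - (K + 2) + b) bs"

lemma stays_nonneg_box_word: "stays_nonneg h (box_word K a bs) \<longleftrightarrow> ballot K (h + a) bs"
proof (induction bs arbitrary: h a)
  case Nil
  then show ?case by (auto simp: box_word_Nil stays_nonneg_U stays_nonneg_D)
next
  case (Cons b bs)
  have "h + a - K - 1 - 1 = h + a - (K + 2)" by simp
  then have "stays_nonneg h (box_word K a (b # bs)) \<longleftrightarrow>
      K \<le> h + a \<and> 0 < h + a - K \<and> 0 < h + a - K - 1 \<and> ballot K (h + a - (K + 2) + b) bs"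
    using Cons[of "h + a - (K + 2)" b]
    by (simp only: box_word_Cons stays_nonneg_U stays_nonneg_D stays_nonneg.simps)
  then show ?case by auto
qed

text \<open>With \<open>m\<close> boxes there are \<open>(K + 2) * m - 1\<close> down steps; the
  equation avoids the subtraction.\<close>

lemma balanced_box_word:
  "balanced (box_word K a bs) \<longleftrightarrow> a + sum_list bs + 1 = (K + 2) * (length bs + 1) \<and> ballot K a bs"
  by (auto simp: balanced_iff stays_nonneg_box_word count_box_word algebra_simps)

section \<open>The case K = 0: translation from Dyck words\<close>

lemma zero_box_word_simps:
  "zero_box_word [] = box_word 0 1 []"
  "zero_box_word (U # d) = U # zero_box_word d"
  "zero_box_word (D # d) = [U, L, D] @ zero_box_word d"
  by (simp_all add: zero_box_word_def box_word_Nil)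

text \<open>Reading \<open>d\<close> from the right, a \<open>U\<close> lengthens the first ascent,
  while a \<open>D\<close> puts a new first box in front and moves the old first exponent into the
  list.\<close>

lemma zero_box_word_is_box_word:
  "set d \<subseteq> {U, D} \<Longrightarrow>
    \<exists>a bs. a \<ge> 1 \<and> (\<forall>b\<in>set bs. b \<ge> 1) \<and> zero_box_word d = box_word 0 a bs"
proof (induction d)
  case Nil
  show ?case by (intro exI[of _ 1] exI[of _ "[]"]) (simp add: zero_box_word_simps)
next
  case (Cons x d)
  then obtain a bs where *: "a \<ge> 1" "\<forall>b\<in>set bs. b \<ge> 1" "zero_box_word d = box_word 0 a bs"
    by auto
  show ?case
  proof (cases "x = U")
    case True
    with * show ?thesis
      by (intro exI[of _ "Suc a"] exI[of _ bs]) (simp add: zero_box_word_simps box_word_Suc)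
  next
    case False
    with Cons.prems have "x = D" by auto
    with * show ?thesis
      by (intro exI[of _ 1] exI[of _ "a # bs"]) (simp add: zero_box_word_simps box_word_Cons)
  qed
qed

lemma box_word_is_zero_box_word:
  assumes "a \<ge> 1" "\<forall>b\<in>set bs. b \<ge> 1"
  shows "\<exists>d. set d \<subseteq> {U, D} \<and> box_word 0 a bs = zero_box_word d"
proof -
  \<comment> \<open>Letters \<open>U\<close> in front of a preimage lengthen the first ascent, so
    only first exponent 1 needs a construction.\<close>
  have run: "\<exists>d. set d \<subseteq> {U, D} \<and> box_word 0 (Suc c) bs = zero_box_word d"
    if "\<exists>d. set d \<subseteq> {U, D} \<and> box_word 0 1 bs = zero_box_word d" for c bs
  proof (induction c)
    case 0
    then show ?case using that by simp
  next
    case (Suc c)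
    then obtain d where "set d \<subseteq> {U, D}" "box_word 0 (Suc c) bs = zero_box_word d" by auto
    then show ?case
      by (intro exI[of _ "U # d"]) (simp add: zero_box_word_simps box_word_Suc)
  qed
  show ?thesis
    using assms
  proof (induction bs arbitrary: a)
    case Nil
    have "\<exists>d. set d \<subseteq> {U, D} \<and> box_word 0 1 [] = zero_box_word d"
      by (intro exI[of _ "[]"]) (simp add: zero_box_word_simps)
    from run[OF this, of "a - 1"] Nil show ?case by simp
  next
    case (Cons b bs)
    then have "\<exists>d. set d \<subseteq> {U, D} \<and> box_word 0 b bs = zero_box_word d" by simp
    then obtain d where "set d \<subseteq> {U, D}" "box_word 0 b bs = zero_box_word d" by blast
    then have "\<exists>d. set d \<subseteq> {U, D} \<and> box_word 0 1 (b # bs) = zero_box_word d"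
      by (intro exI[of _ "D # d"]) (simp add: zero_box_word_simps box_word_Cons)
    from run[OF this, of "a - 1"] Cons.prems show ?case by simp
  qed
qed

lemma count_zero_box_word:
  assumes "set d \<subseteq> {U, D}"
  shows "count_list (zero_box_word d) U = count_list d U + count_list d D + 1"
    "count_list (zero_box_word d) D = count_list d D"
    "count_list (zero_box_word d) L = count_list d D + 1"
  using assms by (induction d) (auto simp: zero_box_word_simps count_box_word)

text \<open>Each inserted UL is a peak that returns at once to the height where it began.\<close>

lemma stays_nonneg_zero_box_word:
  "set d \<subseteq> {U, D} \<Longrightarrow> stays_nonneg h (zero_box_word d) \<longleftrightarrow> stays_nonneg h d"
  by (induction d arbitrary: h) (auto simp: zero_box_word_simps box_word_Nil)

lemma balanced_zero_box_word:
  assumes "set d \<subseteq> {U, D}"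
  shows "balanced (zero_box_word d) \<longleftrightarrow> balanced d"
proof -
  have "count_list d L = 0" using assms by (auto simp: count_list_0_iff)
  then show ?thesis
    using assms by (auto simp: balanced_iff count_zero_box_word stays_nonneg_zero_box_word)
qed

section \<open>The common normal form of box paths\<close>

lemma box_path_iff:
  "box_path K (n + 1) w \<longleftrightarrow>
    (\<exists>a bs. a \<ge> 1 \<and> (\<forall>b\<in>set bs. b \<ge> 1) \<and> length bs = n \<and> balanced (box_word K a bs) \<and>
       w = box_word K a bs)"
proof (cases "K = 0")
  case True
  show ?thesis
  proof
    assume "box_path K (n + 1) w"
    with True obtain d where d: "set d \<subseteq> {U, D}" "balanced d" "count_list d U = n" "w = zero_box_word d"
      by (auto simp: box_path_def dyck_path_def semilength_def)
    then obtain a bs where ab: "a \<ge> 1" "\<forall>b\<in>set bs. b \<ge> 1" "w = box_word 0 a bs"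
      using zero_box_word_is_box_word by blast
    have "count_list d L = 0" using d by (auto simp: count_list_0_iff)
    \<comment> \<open>Comparing the numbers of \<open>L\<close>: one per box, and one more than the
      letters \<open>D\<close> in \<open>d\<close>.\<close>
    then have "length bs = n"
      using d count_zero_box_word(3)[OF d(1)] ab count_box_word(3)[of 0 a bs]
      by (simp add: balanced_def)
    moreover have "balanced w" using d balanced_zero_box_word by simp
    ultimately show "\<exists>a bs. a \<ge> 1 \<and> (\<forall>b\<in>set bs. b \<ge> 1) \<and> length bs = n \<and>
        balanced (box_word K a bs) \<and> w = box_word K a bs"
      using ab True by blast
  next
    assume "\<exists>a bs. a \<ge> 1 \<and> (\<forall>b\<in>set bs. b \<ge> 1) \<and> length bs = n \<and>
        balanced (box_word K a bs) \<and> w = box_word K a bs"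
    then obtain a bs where ab: "a \<ge> 1" "\<forall>b\<in>set bs. b \<ge> 1" "length bs = n" "balanced w"
      "w = box_word 0 a bs"
      using True by auto
    then obtain d where d: "set d \<subseteq> {U, D}" "w = zero_box_word d"
      using box_word_is_zero_box_word by blast
    have "balanced d" using ab(4) d balanced_zero_box_word by blast
    moreover have "count_list d L = 0" using d by (auto simp: count_list_0_iff)
    ultimately have "count_list d U = n"
      using d count_zero_box_word(3)[OF d(1)] ab count_box_word(3)[of 0 a bs]
      by (simp add: balanced_def)
    with \<open>balanced d\<close> d True show "box_path K (n + 1) w"
      by (auto simp: box_path_def dyck_path_def semilength_def)
  qed
next
  case False
  show ?thesis
  proof
    assume "box_path K (n + 1) w"
    with False have w: "skew_dyck_path w" "count_list w U + 1 = (K + 2) * (n + 1)"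
      "occurrences (box K) w = n + 1"
      by (auto simp: box_path_def semilength_def)
    \<comment> \<open>The prescribed semilength makes \<open>box_count_bound\<close> tight, which
      yields the box form.\<close>
    then have "(K + 2) * occurrences (box K) w = count_list w D + count_list w L + 1"
      by (simp add: skew_dyck_path_def balanced_def)
    then obtain a bs where ab: "a \<ge> 1" "\<forall>b\<in>set bs. b \<ge> 1" "w = box_word K a bs"
      using box_count_bound[of w K] w(1) unfolding skew_dyck_path_def by blast
    moreover have "length bs = n"
      using occurrences_box_word[OF ab(1,2), of K] w(3) ab(3) by simp
    ultimately show "\<exists>a bs. a \<ge> 1 \<and> (\<forall>b\<in>set bs. b \<ge> 1) \<and> length bs = n \<and>
        balanced (box_word K a bs) \<and> w = box_word K a bs"
      using w(1) by (auto simp: skew_dyck_path_def)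
  next
    assume "\<exists>a bs. a \<ge> 1 \<and> (\<forall>b\<in>set bs. b \<ge> 1) \<and> length bs = n \<and>
        balanced (box_word K a bs) \<and> w = box_word K a bs"
    then obtain a bs where ab: "a \<ge> 1" "\<forall>b\<in>set bs. b \<ge> 1" "length bs = n"
      "balanced (box_word K a bs)" "w = box_word K a bs" by auto
    have "skew_dyck_path w"
      using box_word_no_turn[of K a bs] ab False by (simp add: skew_dyck_path_def)
    moreover have "semilength w + 1 = (K + 2) * (n + 1)"
      using ab by (simp add: balanced_box_word semilength_def count_box_word)
    moreover have "occurrences (box K) w = n + 1"
      using occurrences_box_word[OF ab(1,2), of K] ab by simp
    ultimately show "box_path K (n + 1) w"
      using False by (simp add: box_path_def)
  qed
qed

section \<open>Long ascents of box words\<close>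

lemma mem_long_ascents:
  "(p, m, s) \<in> long_ascents w \<longleftrightarrow>
    w = p @ replicate m U @ s \<and> 2 \<le> m \<and> (p = [] \<or> last p \<noteq> U) \<and> (s = [] \<or> hd s \<noteq> U)"
  by (auto simp: long_ascents_def ascents_def)

lemma mem_shifted_ascents:
  "(p, m, s) \<in> (\<lambda>(q, m, s). (u @ q, m, s)) ` X \<longleftrightarrow> (\<exists>q. p = u @ q \<and> (q, m, s) \<in> X)"
  by force

text \<open>A letter other than \<open>U\<close> neither starts nor extends an ascent. The shift is
  written \<open>[c] @ p\<close> to match \<open>mem_shifted_ascents\<close>.\<close>

lemma long_ascents_Cons:
  assumes "c \<noteq> U"
  shows "long_ascents (c # v) = (\<lambda>(p, m, s). ([c] @ p, m, s)) ` long_ascents v"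
proof -
  have "(p, m, s) \<in> long_ascents (c # v) \<longleftrightarrow>
    (p, m, s) \<in> (\<lambda>(p, m, s). ([c] @ p, m, s)) ` long_ascents v" for p m s
  proof (cases p)
    case Nil
    then show ?thesis
      using assms unfolding mem_long_ascents mem_shifted_ascents by (cases m) simp_all
  next
    case (Cons x q)
    then show ?thesis
      using assms unfolding mem_long_ascents mem_shifted_ascents by auto
  qed
  then show ?thesis by (simp add: set_eq_iff del: append.simps)
qed

text \<open>By maximality an ascent of the whole word is either the entire initial run or lies
  within \<open>v\<close>.\<close>

lemma long_ascents_run:
  assumes "hd v \<noteq> U" "v \<noteq> []"
  shows "long_ascents (replicate a U @ v) =
    (if a \<ge> 2 then {([], a, v)} else {}) \<union>
    (\<lambda>(p, m, s). (replicate a U @ p, m, s)) ` long_ascents v"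
proof -
  have "(p, m, s) \<in> long_ascents (replicate a U @ v) \<longleftrightarrow>
    a \<ge> 2 \<and> p = [] \<and> m = a \<and> s = v \<or> (\<exists>q. p = replicate a U @ q \<and> (q, m, s) \<in> long_ascents v)"
    (is "?A \<longleftrightarrow> ?B") for p m s
  proof
    assume ?A
    then have *: "replicate a U @ v = p @ replicate m U @ s" "m \<ge> 2" "p = [] \<or> last p \<noteq> U"
      "s = [] \<or> hd s \<noteq> U"
      unfolding mem_long_ascents by blast+
    show ?B
    proof (cases "p = []")
      case True
      have "s \<noteq> []"
      proof
        assume "s = []"
        with *(1) True have "replicate a U @ v = replicate m U" by simp
        then have "set v \<subseteq> set (replicate m U)" by (metis Un_upper2 set_append)
        then have "hd v = U" using hd_in_set[OF assms(2)] by (auto split: if_splits)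
        with assms(1) show False by simp
      qed
      then have "a = m \<and> v = s"
        using * True assms replicate_append_cancel[of a U v m s] by simp
      with * True show ?thesis by simp
    next
      case False
      \<comment> \<open>The left part \<open>p\<close> cannot end inside the run, as its last letter
        would be \<open>U\<close>.\<close>
      have no: "replicate a U \<noteq> p @ u" for u
      proof
        assume "replicate a U = p @ u"
        then have "set p \<subseteq> set (replicate a U)" by simp
        then have "last p = U" using last_in_set[OF False] by (auto split: if_splits)
        with False * show False by simp
      qed
      obtain q where "replicate a U = p @ q \<or> p = replicate a U @ q \<and> v = q @ replicate m U @ s"
        using *(1) unfolding append_eq_append_conv2[of "replicate a U" v p] by blast
      with no have q: "p = replicate a U @ q" "v = q @ replicate m U @ s" by blast+
      have "q \<noteq> []" using no[of "[]"] q(1) by auto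
      with * q False have "(q, m, s) \<in> long_ascents v"
        unfolding mem_long_ascents by simp
      with q show ?thesis by blast
    qed
  next
    assume ?B
    then show ?A
    proof
      assume "\<exists>q. p = replicate a U @ q \<and> (q, m, s) \<in> long_ascents v"
      then obtain q where q: "p = replicate a U @ q" "(q, m, s) \<in> long_ascents v" by blast
      \<comment> \<open>Since \<open>v\<close> does not start with \<open>U\<close>, no ascent of
        \<open>v\<close> has an empty left part; so prepending the run does not extend it.\<close>
      have "q \<noteq> []"
        using q(2) assms unfolding mem_long_ascents by (cases m) auto
      with q show ?A unfolding mem_long_ascents by simp
    qed (use assms in \<open>simp add: mem_long_ascents\<close>)
  qed
  then show ?thesis
    by (auto simp: mem_shifted_ascents)
qed

lemma card_long_ascents_run:
  assumes "hd v \<noteq> U" "v \<noteq> []" "finite (long_ascents v)"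
  shows "finite (long_ascents (replicate a U @ v)) \<and>
    card (long_ascents (replicate a U @ v)) = (if a \<ge> 2 then 1 else 0) + card (long_ascents v)"
proof -
  \<comment> \<open>Only the initial run has an empty left part, so the union is disjoint.\<close>
  have "([], a, v) \<notin> (\<lambda>(p, m, s). (replicate a U @ p, m, s)) ` long_ascents v" if "a \<ge> 2"
    using that by auto
  moreover have "inj_on (\<lambda>(p, m, s). (replicate a U @ p, m, s)) (long_ascents v)"
    by (auto simp: inj_on_def)
  ultimately show ?thesis
    using assms by (simp add: long_ascents_run card_image)
qed

lemma card_long_ascents_down:
  assumes "U \<notin> set u"
  shows "(finite (long_ascents (u @ v)) \<longleftrightarrow> finite (long_ascents v)) \<and>
    card (long_ascents (u @ v)) = card (long_ascents v)"
  using assms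
proof (induction u)
  case (Cons c u)
  have "inj_on (\<lambda>(p, m, s). ([c] @ p, m, s)) X" for X :: "(step list \<times> nat \<times> step list) set"
    by (auto simp: inj_on_def)
  with Cons show ?case
    by (auto simp: long_ascents_Cons card_image finite_image_iff)
qed simp

text \<open>Down steps separate the ascents, so each exponent is judged on its own. Finiteness is
  carried along so that \<open>card\<close> adds up in the induction.\<close>

lemma card_long_ascents_box_word:
  "finite (long_ascents (box_word K a bs)) \<and>
   card (long_ascents (box_word K a bs)) = length (filter (\<lambda>b. b \<ge> 2) (a # bs))"
proof (induction bs arbitrary: a)
  case Nil
  have "long_ascents [] = {}" by (auto simp: long_ascents_def ascents_def)
  then show ?case
    using card_long_ascents_down[of "replicate K D @ [L]" "[]"]
      card_long_ascents_run[of "replicate K D @ [L]" a]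
    by (simp add: box_word_Nil hd_replicate_D)
next
  case (Cons b bs)
  then show ?case
    using card_long_ascents_down[of "replicate K D @ [L, D]" "box_word K b bs"]
      card_long_ascents_run[of "replicate K D @ L # D # box_word K b bs" a]
    by (simp add: box_word_Cons hd_replicate_D)
qed

section \<open>Exponent lists with one long entry\<close>

text \<open>Each descent followed by a single \<open>U\<close> loses \<open>K + 1\<close>, so the
  last of the \<open>i\<close> descents is the most demanding:
  \<open>(K + 1) * (i - 1) + (K + 2) \<le> h\<close>. For \<open>i = 0\<close> there is no descent
  to test.\<close>

lemma ballot_replicate_Suc_0:
  "ballot K h (replicate i (Suc 0) @ bs) \<longleftrightarrow> (if i = 0 then ballot K h bs else
     (K + 1) * i + 1 \<le> h \<and> ballot K (h - (K + 1) * i) bs)"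
proof (induction i arbitrary: h)
  case (Suc i)
  show ?case
  proof (cases "K + 2 \<le> h")
    case True
    then have "h - (K + 2) + Suc 0 = h - (K + 1)" by simp
    then show ?thesis
      using True Suc[of "h - (K + 1)"] by (auto simp: algebra_simps)
  next
    case False
    then show ?thesis by auto
  qed
qed simp

text \<open>Heights fall by \<open>K + 1\<close> per box except at the long ascent. The only real
  constraint is the descent just before it, and the total turns this into an upper bound on
  \<open>b\<close>.\<close>

lemma balanced_two_long_iff:
  assumes "n = i + r + 1" "b \<ge> 2"
  shows "balanced (box_word K a (replicate i 1 @ b # replicate r 1)) \<longleftrightarrow>
    a + b = (K + 1) * (n + 1) + 1 \<and> b \<le> (K + 1) * (r + 1)"
proof -
  let ?c = "(K + 1) * i"
  have tail: "ballot K h (b # replicate r 1) \<longleftrightarrow> K + 2 \<le> h"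
    if "h + b = (K + 1) * (r + 2) + 1" for h
  proof -
    \<comment> \<open>The total puts the top of the long ascent at \<open>(K + 1) * (r + 1)\<close>,
      exactly enough for the \<open>r + 1\<close> boxes that remain.\<close>
    have "ballot K h' (replicate r (Suc 0))" if "h' = (K + 1) * (r + 1)" for h'
      using that ballot_replicate_Suc_0[of K h' r "[]"] by (auto simp: algebra_simps)
    with that show ?thesis by (auto simp: algebra_simps)
  qed
  have sum: "a + sum_list (replicate i 1 @ b # replicate r 1) + 1 =
      (K + 2) * (length (replicate i 1 @ b # replicate r 1) + 1) \<longleftrightarrow>
      a + b = (K + 1) * (n + 1) + 1"
    using assms by (auto simp: sum_list_replicate algebra_simps)
  have "ballot K a (replicate i 1 @ b # replicate r 1) \<longleftrightarrow> b \<le> (K + 1) * (r + 1)"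
    if "a + b = (K + 1) * (n + 1) + 1"
  proof -
    have eq: "a + b = ?c + (K + 1) * (r + 2) + 1"
      using that assms by (simp add: algebra_simps)
    show ?thesis
    proof (cases "?c \<le> a")
      case True
      then have "(a - ?c) + b = (K + 1) * (r + 2) + 1" using eq by linarith
      note tail[OF this]
      moreover have "K + 2 \<le> a - ?c \<longleftrightarrow> b \<le> (K + 1) * (r + 1)"
        using eq True by (auto simp: algebra_simps)
      ultimately show ?thesis
        using ballot_replicate_Suc_0[of K a i "b # replicate r 1"] True by auto
    next
      case False
      \<comment> \<open>If the short ascents already exhaust the height, then \<open>b\<close> is
        too large as well, and both sides fail.\<close>
      then have "\<not> b \<le> (K + 1) * (r + 1)"
        using eq by (auto simp: algebra_simps)
      with False show ?thesis
        using ballot_replicate_Suc_0[of K a i "b # replicate r 1"] by auto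
    qed
  qed
  with sum show ?thesis by (auto simp: balanced_box_word)
qed

lemma one_long_split:
  assumes "\<forall>b\<in>set bs. b \<ge> (1::nat)" "length (filter (\<lambda>b. b \<ge> 2) bs) = 1"
  obtains i b r where "bs = replicate i 1 @ b # replicate r 1" "b \<ge> 2"
proof -
  obtain b where b: "filter (\<lambda>b. b \<ge> 2) bs = [b]"
    using assms(2) by (auto simp: length_Suc_conv)
  then obtain us vs where *: "bs = us @ b # vs" "\<forall>u\<in>set us. \<not> u \<ge> 2" "b \<ge> 2"
    "[] = filter (\<lambda>b. b \<ge> 2) vs"
    by (auto simp: filter_eq_Cons_iff)
  have ones: "replicate (length xs) 1 = xs" if "\<forall>x\<in>set xs. \<not> x \<ge> 2" "set xs \<subseteq> set bs" for xs
    using that assms(1) by (intro replicate_eqI[symmetric]) (auto simp: subset_iff le_antisym not_le less_Suc_eq_le numeral_2_eq_2)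
  have "\<forall>x\<in>set vs. \<not> x \<ge> 2"
    using *(4)[symmetric] by (simp add: filter_empty_conv)
  with * ones have "replicate (length us) 1 = us" "replicate (length vs) 1 = vs"
    by auto
  with * that show ?thesis by metis
qed

text \<open>Here \<open>b\<close> is the long exponent and \<open>r\<close> the number of ones
  behind it; \<open>n\<close> fixes the ones before it and balance the first exponent.\<close>

lemma two_long_box_paths:
  assumes "n \<ge> 1"
  shows "{w. box_path K (n + 1) w \<and> card (long_ascents w) = 2} =
    (\<lambda>(r, b). box_word K ((K + 1) * (n + 1) + 1 - b) (replicate (n - 1 - r) 1 @ b # replicate r 1)) `
      (SIGMA r:{..<n}. {2..(K + 1) * (r + 1)})" (is "?A = ?g ` ?S")
proof (rule set_eqI, rule iffI)
  fix w
  assume "w \<in> ?A"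
  then obtain a bs where ab: "a \<ge> 1" "\<forall>b\<in>set bs. b \<ge> 1" "length bs = n"
    "balanced (box_word K a bs)" "w = box_word K a bs"
    "length (filter (\<lambda>b. b \<ge> 2) (a # bs)) = 2"
    using card_long_ascents_box_word by (auto simp: box_path_iff[unfolded Suc_eq_plus1[symmetric]])
  \<comment> \<open>As \<open>n \<ge> 1\<close>, a separator follows the first box, so the first
    descent has length \<open>K + 2\<close>.\<close>
  have "a \<ge> 2" using ab assms by (cases bs) (auto simp: balanced_box_word)
  then have "length (filter (\<lambda>b. b \<ge> 2) bs) = 1" using ab by simp
  then obtain i b r where split: "bs = replicate i 1 @ b # replicate r 1" "b \<ge> 2"
    using one_long_split ab(2) by blast
  then have n: "n = i + r + 1" using ab by simp
  have *: "a + b = (K + 1) * (n + 1) + 1" "b \<le> (K + 1) * (r + 1)"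
    using balanced_two_long_iff[OF n split(2)] ab(4) split(1) by simp_all
  have "a = (K + 1) * (n + 1) + 1 - b" "i = n - 1 - r"
    using *(1) n by linarith+
  then have "w = ?g (r, b)" using ab(5) split(1) by simp
  moreover have "(r, b) \<in> ?S" using n split(2) *(2) by simp
  ultimately show "w \<in> ?g ` ?S" by (rule image_eqI)
next
  fix w
  assume "w \<in> ?g ` ?S"
  then obtain r b where rb: "r < n" "2 \<le> b" "b \<le> (K + 1) * (r + 1)" "w = ?g (r, b)"
    by auto
  define i where "i = n - 1 - r"
  define a where "a = (K + 1) * (n + 1) + 1 - b"
  let ?bs = "replicate i 1 @ b # replicate r 1"
  have n: "n = i + r + 1" using rb i_def by simp
  have w: "w = box_word K a ?bs" using rb by (simp add: i_def a_def)
  \<comment> \<open>Hence the subtraction defining \<open>a\<close> is exact and the first ascent is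
    long.\<close>
  have "b + (K + 1) * (i + 1) \<le> (K + 1) * (n + 1)" using rb n by (simp add: algebra_simps)
  then have ab: "a + b = (K + 1) * (n + 1) + 1" and a: "a \<ge> 2"
    by (auto simp: a_def)
  have "balanced (box_word K a ?bs)"
    using balanced_two_long_iff[OF n rb(2)] ab rb(3) by simp
  then have "box_path K (n + 1) w"
    unfolding box_path_iff using w a n rb(2)
    by (intro exI[of _ a] exI[of _ ?bs]) auto
  moreover have "card (long_ascents w) = 2"
    using card_long_ascents_box_word[of K a ?bs] w a rb(2) by simp
  ultimately show "w \<in> ?A" by simp
qed

section \<open>Counting and summation\<close>

text \<open>The upper end \<open>(K + 1) * (r + 1)\<close> is at least 1, so the truncated
  subtraction gives the size of the interval even when it is empty.\<close>

lemma card_two_long_box_paths: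
  assumes "n \<ge> 1"
  shows "card {w. box_path K (n + 1) w \<and> card (long_ascents w) = 2} =
    (\<Sum>r<n. (K + 1) * (r + 1) - 1)"
proof -
  \<comment> \<open>The leading ones recover the position of the long exponent, and thus
    \<open>r\<close>.\<close>
  have tw: "takeWhile (\<lambda>x. x < 2) (replicate i 1 @ b # replicate r (1::nat)) = replicate i 1"
    if "b \<ge> 2" for i r b :: nat
    using that by (induction i) simp_all
  have "inj_on (\<lambda>(r, b). box_word K ((K + 1) * (n + 1) + 1 - b)
      (replicate (n - 1 - r) 1 @ b # replicate r 1)) (SIGMA r:{..<n}. {2..(K + 1) * (r + 1)})"
  proof (rule inj_onI, clarify)
    fix r b r' b'
    assume *: "r < n" "b \<in> {2..(K + 1) * (r + 1)}" "r' < n" "b' \<in> {2..(K + 1) * (r' + 1)}"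
      "box_word K ((K + 1) * (n + 1) + 1 - b) (replicate (n - 1 - r) 1 @ b # replicate r 1) =
       box_word K ((K + 1) * (n + 1) + 1 - b') (replicate (n - 1 - r') 1 @ b' # replicate r' 1)"
    then have eq: "replicate (n - 1 - r) 1 @ b # replicate r 1 =
        replicate (n - 1 - r') 1 @ b' # replicate r' 1"
      unfolding box_word_inject by simp
    have "replicate (n - 1 - r) (1::nat) = replicate (n - 1 - r') 1"
      using tw[of b "n - 1 - r" r] tw[of b' "n - 1 - r'" r'] *(2,4) unfolding eq
      by (metis atLeastAtMost_iff)
    then have "n - 1 - r = n - 1 - r'" by (metis length_replicate)
    then have "r = r'" using *(1,3) by linarith
    with eq show "r = r' \<and> b = b'" by simp
  qed
  then show ?thesis
    unfolding two_long_box_paths[OF assms] by (simp add: card_image)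
qed

theorem theorem7p4:
  fixes k n :: nat
  assumes "k \<ge> 3" and "n \<ge> 1"
  shows "second_polygonal k n = real n / 2 * ((real k - 2) * real n + (real k - 4)) \<and>
         second_polygonal k n =
           real (card {w. box_path (k - 3) (n + 1) w \<and> card (long_ascents w) = 2})"
proof -
  define K where "K = k - 3"
  have k: "real k = real K + 3" using assms by (simp add: K_def)
  have poly: "second_polygonal k n = real n / 2 * ((real k - 2) * real n + (real k - 4))"
    by (simp add: second_polygonal_def polygonal_def field_simps)
  \<comment> \<open>An arithmetic sum; with \<open>k = K + 3\<close> the coefficients
    \<open>K + 1\<close> and \<open>K - 1\<close> become \<open>k - 2\<close> and
    \<open>k - 4\<close>.\<close>
  have sum: "real (\<Sum>r<m. (K + 1) * (r + 1) - 1) = real m / 2 * ((real K + 1) * real m + (real K - 1))" for m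
  proof (induction m)
    case (Suc m)
    have "real ((K + 1) * (m + 1) - 1) = (real K + 1) * (real m + 1) - 1"
      by (simp add: of_nat_diff algebra_simps)
    with Suc show ?case by (simp add: field_simps)
  qed simp
  have "second_polygonal k n = real (card {w. box_path K (n + 1) w \<and> card (long_ascents w) = 2})"
    unfolding card_two_long_box_paths[OF assms(2)] sum poly k by (simp add: algebra_simps)
  with poly show ?thesis unfolding K_def by blast
qed

end
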